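(* Let $p$ be an odd prime, let $s,h,t,r$ be positive integers with $r$ odd, $t\mid h$, $s<h$, and let $q=p^h$ satisfy $q\equiv1\pmod8$ or $q\equiv3\pmod8$. Put $n=rp^s$. Assume that $\mathbb{F}_q$ is the splitting field of $g(x)=x^{n}+\sum_{i=1}^{\frac{n-1}{2}}a_ix^{n-i}+c\in\mathbb{F}_{p^t}[x]$ with $c\neq0$ and $a_i\ne0$ for $1\le i\le\frac{n-1}{2}$, and that $\alpha_1,\dots,\alpha_n$ are all the roots of $g(x)$ and are pairwise distinct. Let $v_i\in\mathbb{F}_{q^2}$ be such that $v_i^2=(g'(\alpha_i))^{-1}$ for $1\le i\le n$ (such $v_i$ exist). Let $\boldsymbol{\alpha}=(\alpha_1,\dots,\alpha_n)$ and $\boldsymbol{v}=(v_1,\dots,v_n)$. Let $\mathcal{D}=\{a\in\mathbb{F}_q^*: a^{\frac{q-1}{2}}=1\}$, let $\eta_{\frac{n+1}{2}}\in\mathcal{D}$, let $\eta_1=\eta_{\frac{n+1}{2}}a_{\frac{n-1}{2}}+(-2\eta_{\frac{n+1}{2}})^{\frac12}$, and let $\eta_i=\eta_{\frac{n+1}{2}}a_{\frac{n+1}{2}-i}$ for $2\le i\le\frac{n-1}{2}$. Set $$\mathcal{S}_2=\Big\{\sum_{i=0}^{\frac{n-3}{2}}f_ix^i+f_0(-2\eta_{\frac{n+1}{2}})^{\frac12}x^{\frac{n-1}{2}}+f_0\,\eta_{\frac{n+1}{2}}\Big(\sum_{j=1}^{\frac{n-1}{2}}a_jx^{n-1-j}+x^{n-1}\Big):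 f_i\in\mathbb{F}_{q^2}\text{ for }0\le i\le\tfrac{n-3}{2}\Big\}.$$ Then $\mathcal{C}_2=ev_{\boldsymbol{\alpha},\boldsymbol{v}}(\mathcal{S}_2)$ is a $[rp^s,\,\frac{rp^s-1}{2}]$ self-orthogonal TGRS code over $\mathbb{F}_{q^2}$.
   Context: $(-2\eta)^{1/2}$ denotes a fixed square root of $-2\eta$ in $\mathbb{F}_q$ (it exists under the stated congruence and $\eta\in\mathcal{D}$). For $\boldsymbol{\alpha}\in\mathbb{F}^n$ with distinct entries and $\boldsymbol{v}\in(\mathbb{F}^* )^n$ ($\mathbb{F}$ a finite field; here $\mathbb{F}=\mathbb{F}_{q^2}$), $ev_{\boldsymbol{\alpha},\boldsymbol{v}}(f)=(v_1f(\alpha_1),\dots,v_nf(\alpha_n))$ for $f\in\mathbb{F}[x]$. For a $k\times(n-k)$ matrix $(\eta_{ij})$ over $\mathbb{F}$, the twisted generalized Reed-Solomon (TGRS) code is the image under $ev_{\boldsymbol{\alpha},\boldsymbol{v}}$ of $\{\sum_{i=0}^{k-1}f_ix^i+\sum_{i=0}^{k-1}f_i\sum_{j=1}^{n-k}\eta_{i+1,j}x^{k-1+j}:f_i\in\mathbb{F}\}$. A linear code is $[n,k]$ if it has length $n$ and dimension $k$. It is self-orthogonal if $\mathcal{C}\subseteq\mathcal{C}^\perp$ for the Euclidean inner product. *)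

theory Defs
  imports "HOL-Analysis.Cartesian_Space" "HOL-Computational_Algebra.Polynomial"
    "HOL-Computational_Algebra.Primes"
begin

definition is_subfield :: "'a::field set \<Rightarrow> bool" where
  "is_subfield K \<longleftrightarrow> 0 \<in> K \<and> 1 \<in> K \<and>
     (\<forall>x\<in>K. \<forall>y\<in>K. x - y \<in> K \<and> x * y \<in> K) \<and> (\<forall>x\<in>K. inverse x \<in> K)"

definition splits_over :: "'a::field poly \<Rightarrow> 'a set \<Rightarrow> bool" where
  "splits_over g K \<longleftrightarrow>
     (\<exists>xs. set xs \<subseteq> K \<and> g = smult (lead_coeff g) (\<Prod>x\<leftarrow>xs. [:- x, 1:]))"

text \<open>\<open>E\<close> is the splitting field of \<open>g \<in> F[x]\<close> over \<open>F\<close>, all fields being subfields of one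
  ambient field.\<close>
definition is_splitting_field :: "'a::field set \<Rightarrow> 'a set \<Rightarrow> 'a poly \<Rightarrow> bool" where
  "is_splitting_field F E g \<longleftrightarrow>
     is_subfield F \<and> is_subfield E \<and> F \<subseteq> E \<and> (\<forall>i. coeff g i \<in> F) \<and> splits_over g E \<and>
     (\<forall>L. is_subfield L \<and> F \<subseteq> L \<and> L \<subseteq> E \<and> splits_over g L \<longrightarrow> L = E)"

definition ev :: "'a::field ^ 'n \<Rightarrow> 'a ^ 'n \<Rightarrow> 'a poly \<Rightarrow> 'a ^ 'n" where
  "ev \<alpha> v f = (\<chi> i. v $ i * poly f (\<alpha> $ i))"

text \<open>The twist matrix \<open>M\<close> is \<open>k \<times> (n - k)\<close> with both indices starting at 1; values outside that
  range are irrelevant.\<close>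
definition tgrs_polys :: "nat \<Rightarrow> nat \<Rightarrow> (nat \<Rightarrow> nat \<Rightarrow> 'a::field) \<Rightarrow> 'a poly set" where
  "tgrs_polys n k M =
     {(\<Sum>i<k. monom (f i) i) +
      (\<Sum>i<k. smult (f i) (\<Sum>j=1..n - k. monom (M (i + 1) j) (k - 1 + j))) | f. True}"

definition is_tgrs_code :: "nat \<Rightarrow> ('a::field ^ 'n::finite) set \<Rightarrow> bool" where
  "is_tgrs_code k C \<longleftrightarrow> 1 \<le> k \<and> k < CARD('n) \<and>
     (\<exists>\<alpha> v M. inj (($) \<alpha>) \<and> (\<forall>i. v $ i \<noteq> 0) \<and> C = ev \<alpha> v ` tgrs_polys CARD('n) k M)"

definition is_linear_code :: "nat \<Rightarrow> nat \<Rightarrow> ('a::field ^ 'n::finite) set \<Rightarrow> bool" where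
  "is_linear_code n k C \<longleftrightarrow> CARD('n) = n \<and> vec.subspace C \<and> vec.dim C = k"

definition dual_code :: "('a::field ^ 'n::finite) set \<Rightarrow> ('a ^ 'n) set" where
  "dual_code C = {x. \<forall>y\<in>C. scalar_product x y = 0}"

definition self_orthogonal :: "('a::field ^ 'n::finite) set \<Rightarrow> bool" where
  "self_orthogonal C \<longleftrightarrow> C \<subseteq> dual_code C"

text \<open>In \<open>S2_polys\<close>, \<open>e\<close> is the last twist \<open>\<eta>\<^bsub>(n+1)/2\<^esub>\<close>, \<open>b\<close> the chosen square root of \<open>-2e\<close>,
  and \<open>n\<close> is odd.\<close>
definition S2_polys :: "nat \<Rightarrow> (nat \<Rightarrow> 'a::field) \<Rightarrow> 'a \<Rightarrow> 'a \<Rightarrow> 'a poly set" where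
  "S2_polys n a e b =
     {(\<Sum>i=0..(n - 3) div 2. monom (f i) i) + monom (f 0 * b) ((n - 1) div 2) +
      smult (f 0 * e) ((\<Sum>j=1..(n - 1) div 2. monom (a j) (n - 1 - j)) + monom 1 (n - 1)) | f. True}"

end

theory Submission
  imports Defs
begin

text \<open>By Lagrange interpolation, \<open>L(f) = \<Sum>\<^sub>i f(\<alpha>\<^sub>i) / g'(\<alpha>\<^sub>i)\<close> is the coefficient of \<open>x^(n-1)\<close> in the
  remainder of \<open>f\<close> modulo \<open>g\<close>, and the inner product of the codewords of \<open>f\<^sub>1\<close> and
  \<open>f\<^sub>2\<close> is \<open>L(f\<^sub>1 f\<^sub>2)\<close>. The twist is built from \<open>G = (g - c) / x\<close>. As \<open>G\<close> is divisible by \<open>x^((n-1)/2)\<close>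
  and \<open>x G\<close> is constant modulo \<open>g\<close>, all products in \<open>S\<^sub>2\<close> can be reduced explicitly; the only
  surviving contribution is a multiple of \<open>b\<^sup>2 + 2 e = 0\<close>.\<close>

section \<open>Finite fields: characteristic, subfields and squares\<close>

text \<open>Translation by 1 permutes the field, so adding 1 to every summand does not change the
  sum of all elements.\<close>

lemma card_eq_0_in_field: "of_nat CARD('a) = (0 :: 'a::{ring_1,finite})"
proof -
  have "(\<Sum>x\<in>UNIV. x :: 'a) = (\<Sum>x\<in>UNIV. x + 1)"
    by (rule sum.reindex_bij_witness[of _ "\<lambda>x. x + 1" "\<lambda>x. x - 1"]) auto
  then show ?thesis
    by (simp add: sum.distrib)
qed

lemma CHAR_eq_of_card_prime_power:
  assumes "prime p" "CARD('a::{field,finite}) = p ^ k"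
  shows "CHAR('a) = p"
proof -
  have "CHAR('a) dvd p ^ k"
    using card_eq_0_in_field[where 'a = 'a] assms(2) by (metis of_nat_eq_0_iff_char_dvd)
  moreover have "prime CHAR('a)"
    by (simp add: finite_imp_CHAR_pos prime_CHAR_semidom)
  ultimately show ?thesis
    using assms(1) by (metis prime_dvd_power primes_dvd_imp_eq)
qed

lemma is_subfield_UNIV: "is_subfield UNIV"
  by (simp add: is_subfield_def)

text \<open>Multiplication by \<open>x\<close> permutes \<open>K - {0}\<close>; comparing the
  product over this set before and after leaves the power of \<open>x\<close>.\<close>

lemma subfield_power_card:
  fixes K :: "'a::{field,finite} set"
  assumes K: "is_subfield K" and x: "x \<in> K" "x \<noteq> 0"
  shows "x ^ (card K - 1) = 1"
proof -
  let ?K = "K - {0}"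
  have "(\<Prod>y\<in>?K. y) = (\<Prod>y\<in>?K. x * y)"
  proof (rule prod.reindex_bij_witness[of _ "\<lambda>y. x * y" "\<lambda>y. inverse x * y"])
    show "x * (inverse x * y) = y" for y using x(2) by simp
    show "inverse x * (x * y) = y" for y using x(2) by (simp flip: mult.assoc)
    show "x * y \<in> ?K" "inverse x * y \<in> ?K" if "y \<in> ?K" for y
      using that K x by (auto simp: is_subfield_def)
  qed (use x in auto)
  also have "\<dots> = x ^ card ?K * (\<Prod>y\<in>?K. y)"
    by (simp add: prod.distrib)
  finally have "x ^ card ?K = 1"
    by simp
  moreover have "card ?K = card K - 1"
    using K by (simp add: is_subfield_def)
  ultimately show ?thesis by simp
qed

text \<open>A counting argument with \<open>card K = 2 * m + 1\<close>: the nonzero squares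
  \<open>Q\<close> lie among the roots \<open>R\<close> of \<open>y ^ m = 1\<close>, of which the
  ambient field has at most \<open>m\<close>. Each square has at most two square roots, so
  \<open>Q\<close> has at least \<open>m\<close> elements and equals \<open>R\<close>.\<close>

lemma subfield_Euler_criterion:
  fixes K :: "'a::{field,finite} set"
  assumes K: "is_subfield K" and odd: "odd (card K)"
    and x: "x \<in> K" "x ^ ((card K - 1) div 2) = 1"
  shows "\<exists>y\<in>K. y ^ 2 = x"
proof -
  define m where "m = (card K - 1) div 2"
  define K' where "K' = K - {0}"
  define Q where "Q = (\<lambda>y. y ^ 2) ` K'"
  define R where "R = {y :: 'a. y ^ m = 1}"
  have K01: "0 \<in> K" "1 \<in> K"
    using K by (auto simp: is_subfield_def)
  have "card {0, 1 :: 'a} \<le> card K"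
    using K01 by (intro card_mono) auto
  then have cK: "card K = 2 * m + 1" "m > 0"
    using odd by (auto simp: m_def elim!: oddE)
  have cK': "card K' = 2 * m"
    using K01 cK by (simp add: K'_def)
  have "Q \<subseteq> R"
    using subfield_power_card[OF K] cK by (auto simp: Q_def R_def K'_def simp flip: power_mult)
  have "card R \<le> m"
  proof -
    let ?P = "monom 1 m - 1 :: 'a poly"
    have "coeff ?P m = 1"
      using cK by simp
    then have "?P \<noteq> 0" by force
    then have "card {y. poly ?P y = 0} \<le> degree ?P"
      by (rule card_poly_roots_bound)
    also have "degree ?P \<le> m"
      by (intro degree_diff_le) (auto simp: degree_monom_le)
    finally show ?thesis
      by (simp add: R_def poly_monom)
  qed
  have fibre: "card {y :: 'a. y ^ 2 = z} \<le> 2" if "z \<in> Q" for z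
  proof -
    obtain w where "z = w ^ 2" using \<open>z \<in> Q\<close> by (auto simp: Q_def)
    then have "{y. y ^ 2 = z} = {w, - w}"
      by (auto simp: power2_eq_iff)
    then show ?thesis
      by (simp add: card_insert_if)
  qed
  have "2 * m \<le> card (\<Union>z\<in>Q. {y :: 'a. y ^ 2 = z})"
    unfolding cK'[symmetric] by (intro card_mono) (auto simp: Q_def)
  also have "\<dots> \<le> (\<Sum>z\<in>Q. card {y :: 'a. y ^ 2 = z})"
    by (intro card_UN_le) simp
  also have "\<dots> \<le> (\<Sum>z\<in>Q. 2)"
    by (intro sum_mono fibre)
  finally have "m \<le> card Q" by simp
  then have "Q = R"
    using \<open>Q \<subseteq> R\<close> \<open>card R \<le> m\<close> by (intro card_seteq) auto
  then have "x \<in> Q"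
    using x by (simp add: R_def m_def)
  then show ?thesis
    by (auto simp: Q_def K'_def)
qed

text \<open>A root \<open>z\<close> of \<open>x\<^sup>4 + 1\<close> gives the square root \<open>z + z\<^sup>3\<close> of \<open>-2\<close>; Frobenius \<open>x \<mapsto> x\<^sup>q\<close>
  fixes it precisely when \<open>q\<close> is 1 or 3 modulo 8.\<close>
lemma minus_two_power:
  fixes q :: nat
  assumes p: "prime p" "q = p ^ h" and q: "q mod 8 = 1 \<or> q mod 8 = 3"
    and card: "CARD('a::{field,finite}) = q ^ 2"
  shows "(- 2 :: 'a) ^ ((q - 1) div 2) = 1"
proof -
  have "CARD('a) mod 8 = (q mod 8) ^ 2 mod 8"
    by (simp add: card power_mod)
  also have "\<dots> = 1" using q by auto
  finally have N: "CARD('a) mod 8 = 1" .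
  then obtain N where N: "CARD('a) = 8 * N + 1"
    by (metis mult_div_mod_eq)
  have CHAR: "CHAR('a) = p"
    using p card by (intro CHAR_eq_of_card_prime_power[of p "h * 2"]) (auto simp: power_mult)
  \<comment> \<open>The exponent \<open>4 * N\<close> is half the order of the multiplicative group
    of the ambient field.\<close>
  have sqrt: "\<exists>y. y ^ 2 = x" if "x ^ (4 * N) = 1" for x :: 'a
    using subfield_Euler_criterion[OF is_subfield_UNIV, of x] that N by auto
  obtain i :: 'a where i: "i ^ 2 = - 1"
    using sqrt[of "- 1"] by auto
  have i4: "i ^ 4 = 1"
    using i power_mult[of i 2 2] by simp
  obtain z where z: "z ^ 2 = i"
    using sqrt[of i] i4 by (auto simp: power_mult)
  have z4: "z ^ 4 = - 1"
    using z i power_mult[of z 2 2] by simp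
  have z8: "z ^ 8 = 1"
    using z4 power_mult[of z 4 2] by simp
  define y where "y = z + z ^ 3"
  \<comment> \<open>The outer terms cancel because \<open>z ^ 4 = - 1\<close>, which leaves
    \<open>2 * z ^ 4\<close>.\<close>
  have "y ^ 2 = z ^ 2 + 2 * z ^ 4 + z ^ 4 * z ^ 2"
    unfolding y_def by algebra
  then have y2: "y ^ 2 = - 2" by (simp add: z4)
  have "(2::'a) \<noteq> 0"
  proof
    assume "(2::'a) = 0"
    moreover have "of_nat CARD('a) = 2 * (4 * of_nat N) + (1::'a)"
      by (simp add: N)
    ultimately have "of_nat CARD('a) = (1::'a)" by simp
    then show False by (simp add: card_eq_0_in_field)
  qed
  then have "y \<noteq> 0" using y2 by auto
  have zq: "z ^ q = z ^ (q mod 8)"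
    by (metis mult_div_mod_eq power_add power_mult z8 power_one mult_1)
  have "y ^ q = z ^ q + (z ^ q) ^ 3"
    unfolding y_def using p CHAR freshmans_dream'[of q h z "z ^ 3"]
    by (simp flip: power_mult add: mult.commute)
  also have "\<dots> = y"
    using q
  proof
    \<comment> \<open>Here Frobenius exchanges the two summands of \<open>y\<close>, since
      \<open>z ^ q = z ^ 3\<close> and \<open>z ^ 9 = z\<close>.\<close>
    assume "q mod 8 = 3"
    then show ?thesis
      using zq power_add[of z 8 1] z8 by (simp add: y_def flip: power_mult)
  qed (simp add: zq y_def)
  finally have "y ^ (q - 1) * y = y"
    using q by (cases q) (auto simp: mult.commute)
  then have "y ^ (q - 1) = 1" using \<open>y \<noteq> 0\<close> by simp
  moreover have "odd q" using q by presburger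
  then have "q - 1 = 2 * ((q - 1) div 2)" by simp
  ultimately show ?thesis
    using y2 by (metis power_mult)
qed

section \<open>Lagrange interpolation at the roots of a monic polynomial\<close>

text \<open>Two monic polynomials of degree \<open>CARD('n)\<close> that agree at
  \<open>CARD('n)\<close> distinct points are equal.\<close>

lemma monic_eq_prod_roots:
  fixes x :: "'n::finite \<Rightarrow> 'a::field" and g :: "'a poly"
  assumes "inj x" "\<And>i. poly g (x i) = 0" "degree g = CARD('n)" "lead_coeff g = 1"
  shows "g = (\<Prod>i\<in>UNIV. [:- x i, 1:])"
proof (rule poly_eqI_degree_lead_coeff[where n = "CARD('n)" and A = "range x"])
  let ?W = "\<Prod>i\<in>UNIV. [:- x i, 1:]"
  have deg: "degree ?W = CARD('n)"
    by (subst degree_prod_eq_sum_degree) auto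
  moreover have "lead_coeff ?W = 1"
    by (simp add: lead_coeff_prod)
  ultimately show "coeff g CARD('n) = coeff ?W CARD('n)" "degree ?W \<le> CARD('n)"
    using assms by auto
  show "poly g z = poly ?W z" if "z \<in> range x" for z
    using that assms(2) by (auto simp: poly_prod)
qed (use assms card_image in fastforce)+

text \<open>In the product rule, every summand that keeps the factor belonging to \<open>x i\<close>
  vanishes at \<open>x i\<close>.\<close>

lemma poly_pderiv_prod_roots:
  fixes x :: "'n::finite \<Rightarrow> 'a::field"
  shows "poly (pderiv (\<Prod>i\<in>UNIV. [:- x i, 1:])) (x i) = (\<Prod>j\<in>UNIV - {i}. x i - x j)"
proof -
  have "poly (pderiv (\<Prod>i\<in>UNIV. [:- x i, 1:])) (x i)
    = (\<Sum>k\<in>UNIV. poly (\<Prod>j\<in>UNIV - {k}. [:- x j, 1:]) (x i))"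
    by (simp add: pderiv_prod poly_sum pderiv_pCons)
  also have "\<dots> = (\<Sum>k\<in>UNIV. if k = i then poly (\<Prod>j\<in>UNIV - {i}. [:- x j, 1:]) (x i) else 0)"
    by (rule sum.cong) (auto simp: poly_prod)
  finally show ?thesis
    by (simp add: poly_prod)
qed

text \<open>\<open>f\<close> equals its Lagrange interpolant \<open>?F\<close>. Each
  \<open>?W i\<close> is monic of degree \<open>CARD('n) - 1\<close>, so the top coefficient of
  \<open>?F\<close> is the sum of its weights.\<close>

lemma lagrange_lead_coeff:
  fixes x :: "'n::finite \<Rightarrow> 'a::field" and f :: "'a poly"
  assumes "inj x" "degree f < CARD('n)"
  shows "(\<Sum>i\<in>UNIV. poly f (x i) / (\<Prod>j\<in>UNIV - {i}. x i - x j)) = coeff f (CARD('n) - 1)"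
proof -
  let ?W = "\<lambda>i. \<Prod>j\<in>UNIV - {i}. [:- x j, 1:]"
  let ?w = "\<lambda>i. \<Prod>j\<in>UNIV - {i}. x i - x j"
  let ?F = "\<Sum>i\<in>UNIV. smult (poly f (x i) / ?w i) (?W i)"
  have w: "?w i \<noteq> 0" for i
    using \<open>inj x\<close> by (auto simp: inj_eq)
  have deg: "degree (?W i) = CARD('n) - 1" for i
    by (subst degree_prod_eq_sum_degree) (auto simp: card_Diff_singleton)
  have "lead_coeff (?W i) = 1" for i
    by (simp add: lead_coeff_prod)
  then have lead: "coeff (?W i) (CARD('n) - 1) = 1" for i
    by (simp add: deg)
  have "f = ?F"
  proof (rule poly_eqI_degree[of "range x"])
    show "poly f z = poly ?F z" if "z \<in> range x" for z
    proof -
      obtain k where k: "z = x k" using \<open>z \<in> range x\<close> by blast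
      have "poly (?W i) (x k) = (if i = k then ?w k else 0)" for i
        by (auto simp: poly_prod)
      then have "poly ?F z = (\<Sum>i\<in>UNIV. if i = k then poly f (x k) / ?w k * ?w k else 0)"
        unfolding poly_sum k poly_smult by (intro sum.cong) auto
      then show ?thesis
        using w[of k] by (simp add: k del: prod_zero_iff)
    qed
    have c: "card (range x) = CARD('n)"
      by (simp add: card_image \<open>inj x\<close>)
    show "card (range x) > degree f"
      using assms c by simp
    have "degree ?F \<le> CARD('n) - 1"
      by (intro degree_sum_le) (auto intro: order.trans[OF degree_smult_le] simp: deg)
    then show "card (range x) > degree ?F"
      using c zero_less_card_finite[where 'a = 'n] by linarith
  qed
  then have "coeff f (CARD('n) - 1) = coeff ?F (CARD('n) - 1)" by simp
  then show ?thesis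
    by (simp add: coeff_sum lead del: One_nat_def)
qed

section \<open>Dimension of TGRS codes\<close>

text \<open>Independence in the library concerns sets of vectors, whereas \<open>ind\<close>
  concerns an indexed family. Injectivity of \<open>B\<close> on the indices translates between the
  two.\<close>

lemma is_linear_code_combinations:
  fixes B :: "nat \<Rightarrow> 'a::field ^ 'n::finite"
  assumes ind: "\<And>f i. (\<Sum>i<k. f i *s B i) = 0 \<Longrightarrow> i < k \<Longrightarrow> f i = 0"
  shows "is_linear_code CARD('n) k {\<Sum>i<k. f i *s B i | f. True}"
proof -
  have inj: "inj_on B {..<k}"
  proof (rule inj_onI, rule ccontr)
    fix i j assume ij: "i \<in> {..<k}" "j \<in> {..<k}" "B i = B j" "i \<noteq> j"
    \<comment> \<open>A repeated vector would give the nontrivial relation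
      \<open>B i - B j = 0\<close>.\<close>
    let ?f = "\<lambda>l. (if l = i then 1 else 0) - (if l = j then 1 else 0) :: 'a"
    have "?f l *s B l = (if l = i then B l else 0) - (if l = j then B l else 0)" for l
      using ij by auto
    then have "(\<Sum>l<k. ?f l *s B l) = 0"
      using ij by (simp add: sum_subtractf)
    from ind[OF this, of i] ij show False by simp
  qed
  have sum_image: "(\<Sum>x\<in>B ` {..<k}. u x *s x) = (\<Sum>i<k. u (B i) *s B i)" for u
    by (simp add: sum.reindex[OF inj])
  have indep: "vec.independent (B ` {..<k})"
  proof (rule vec.independent_if_scalars_zero)
    fix u x assume "(\<Sum>x\<in>B ` {..<k}. u x *s x) = 0" "x \<in> B ` {..<k}"
    then show "u x = 0"
      using ind[of "\<lambda>i. u (B i)"] by (auto simp: sum_image)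
  qed simp
  have "{\<Sum>i<k. f i *s B i | f. True} = vec.span (B ` {..<k})"
  proof -
    have "\<exists>u. (\<Sum>i<k. f i *s B i) = (\<Sum>i<k. u (B i) *s B i)" for f
      by (rule exI[of _ "\<lambda>x. f (the_inv_into {..<k} B x)"])
        (simp add: the_inv_into_f_f[OF inj])
    then show ?thesis
      by (auto simp: vec.span_finite sum_image)
  qed
  then show ?thesis
    using indep by (simp add: is_linear_code_def vec.subspace_span vec.dim_eq_card_independent
        card_image inj)
qed

text \<open>Generators \<open>P i\<close> have degree below \<open>CARD('n)\<close>, so evaluation
  at distinct points loses nothing. All twist terms have degree at least \<open>k\<close>, so the
  coefficients below \<open>k\<close> of a combination are the scalars themselves.\<close>

lemma is_linear_code_tgrs:
  fixes \<alpha> v :: "'a::field ^ 'n::finite"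
  assumes "inj (($) \<alpha>)" "\<And>i. v $ i \<noteq> 0" "1 \<le> k" "k \<le> CARD('n)"
  shows "is_linear_code CARD('n) k (ev \<alpha> v ` tgrs_polys CARD('n) k M)"
proof -
  define P where "P i = monom 1 i + (\<Sum>j=1..CARD('n) - k. monom (M (i + 1) j) (k - 1 + j))" for i
  have comb: "(\<Sum>i<k. monom (f i) i) +
      (\<Sum>i<k. smult (f i) (\<Sum>j=1..CARD('n) - k. monom (M (i + 1) j) (k - 1 + j)))
      = (\<Sum>i<k. smult (f i) (P i))" for f
    by (simp add: P_def smult_add_right smult_monom sum.distrib)
  have ev_comb: "ev \<alpha> v (\<Sum>i<k. smult (f i) (P i)) = (\<Sum>i<k. f i *s ev \<alpha> v (P i))" for f
    by (simp add: vec_eq_iff ev_def poly_sum sum_distrib_left mult_ac)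
  have C: "ev \<alpha> v ` tgrs_polys CARD('n) k M = {\<Sum>i<k. f i *s ev \<alpha> v (P i) | f. True}"
    unfolding tgrs_polys_def comb by (auto simp flip: ev_comb)
  \<comment> \<open>Since \<open>j\<close> starts at 1 and \<open>k\<close> is positive, the
    exponent \<open>k - 1 + j\<close> is never below \<open>k\<close>.\<close>
  have coeff_P: "coeff (P i) l = (if l = i then 1 else 0)" if "l < k" for i l
    using that \<open>1 \<le> k\<close> by (auto simp: P_def coeff_sum intro!: sum.neutral)
  have "degree (P i) < CARD('n)" if "i < k" for i
  proof -
    have "degree (P i) \<le> CARD('n) - 1"
      unfolding P_def using that assms(3,4)
      by (intro degree_add_le degree_sum_le order.trans[OF degree_monom_le]) auto
    then show ?thesis
      using assms(3,4) by linarith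
  qed
  then have deg: "degree (\<Sum>i<k. smult (f i) (P i)) < CARD('n)" for f
    using assms(3,4) by (intro degree_sum_less) (auto intro: le_less_trans[OF degree_smult_le])
  show ?thesis
    unfolding C
  proof (rule is_linear_code_combinations)
    fix f l assume "(\<Sum>i<k. f i *s ev \<alpha> v (P i)) = 0" and l: "l < k"
    then have "poly (\<Sum>i<k. smult (f i) (P i)) (\<alpha> $ i) = 0" for i
      unfolding ev_comb[symmetric] using assms(2) by (simp add: ev_def vec_eq_iff)
    then have "(\<Sum>i<k. smult (f i) (P i)) = 0"
      using deg assms(1)
      by (intro poly_eqI_degree[of "range (($) \<alpha>)"]) (auto simp: card_image)
    then have "coeff (\<Sum>i<k. smult (f i) (P i)) l = 0" by simp
    then show "f l = 0"
      using l by (simp add: coeff_sum coeff_P if_distrib cong: if_cong)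
  qed
qed

section \<open>The set \<open>S2_polys\<close> as a twisted family and its products\<close>

lemma smult_sum2: "smult c (\<Sum>i\<in>A. f i) = (\<Sum>i\<in>A. smult c (f i))"
  by (induction A rule: infinite_finite_induct) (auto simp: smult_add_right)

text \<open>Only \<open>f 0\<close> is twisted, so only the first row is nonzero. Column
  \<open>j\<close> belongs to \<open>x^(m-1+j)\<close>; the row lists \<eta>_1, ..., \<eta>_(m+1):
  first \<open>e * a m + b\<close>, then \<open>e * a (m + 1 - j)\<close>, and finally
  \<open>e\<close>.\<close>

lemma S2_polys_eq_tgrs_polys:
  assumes "m \<ge> 1"
  shows "S2_polys (2 * m + 1) a e b = tgrs_polys (2 * m + 1) m
    (\<lambda>i j. if i = 1 then (if j = 1 then b else 0) + e * (if j = m + 1 then 1 else a (m + 1 - j))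
            else 0)" (is "_ = tgrs_polys _ _ ?M")
proof -
  have set: "{0..(2 * m + 1 - 3) div 2} = {..<m}"
    using assms by auto
  have twist: "(\<Sum>j=1..2 * m + 1 - m. monom (?M (i + 1) j) (m - 1 + j)) =
      (if i = 0 then monom b m + smult e ((\<Sum>j=1..m. monom (a j) (2 * m - j)) + monom 1 (2 * m))
       else 0)" for i
  proof (cases "i = 0")
    case True
    have "(\<Sum>j=1..2 * m + 1 - m. monom (?M (i + 1) j) (m - 1 + j))
      = (\<Sum>j=1..m + 1. (if j = 1 then monom b m else 0)
          + smult e (monom (if j = m + 1 then 1 else a (m + 1 - j)) (m - 1 + j)))"
      using True assms by (auto simp: smult_monom simp flip: add_monom intro!: sum.cong)
    also have "\<dots> = monom b m
        + smult e (\<Sum>j=1..m + 1. monom (if j = m + 1 then 1 else a (m + 1 - j)) (m - 1 + j))"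
      unfolding sum.distrib smult_sum2 by simp
    also have "(\<Sum>j=1..m + 1. monom (if j = m + 1 then 1 else a (m + 1 - j)) (m - 1 + j))
      = (\<Sum>j=1..m. monom (a (m + 1 - j)) (m - 1 + j)) + monom 1 (2 * m)"
      using assms by (simp add: mult_2)
    \<comment> \<open>Reversing the order of summation turns the exponent \<open>m - 1 + j\<close>
      into \<open>2 * m - j\<close>.\<close>
    also have "(\<Sum>j=1..m. monom (a (m + 1 - j)) (m - 1 + j)) = (\<Sum>j=1..m. monom (a j) (2 * m - j))"
      by (rule sum.reindex_bij_witness[of _ "\<lambda>j. m + 1 - j" "\<lambda>j. m + 1 - j"]) 
        (auto intro!: arg_cong2[where f = monom])
    finally show ?thesis
      using True by simp
  qed simp
  have "(\<Sum>i<m. smult (f i) (if i = 0 then R else 0)) = smult (f 0) R" for f and R :: "'a poly"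
    using assms by (simp add: if_distrib[of "smult _"] cong: if_cong)
  then show ?thesis
    unfolding S2_polys_def tgrs_polys_def set twist
    by (simp add: smult_add_right smult_monom add.assoc)
qed

text \<open>In the proof \<open>y H\<close> is the polynomial \<open>G = (g - c) / x\<close> and \<open>y = x^m\<close>.\<close>
lemma S2_product_annihilated:
  fixes L :: "'a::field poly \<Rightarrow> 'a" and a :: "nat \<Rightarrow> 'a"
  assumes "m \<ge> 1"
    and g: "g = monom 1 (2 * m + 1) + (\<Sum>i=1..m. monom (a i) (2 * m + 1 - i)) + [:c:]"
    and add: "\<And>P Q. L (P + Q) = L P + L Q"
    and smult: "\<And>d P. L (smult d P) = d * L P"
    and multiple: "\<And>P. L (g * P) = 0"
    and coeff: "\<And>P. (\<And>k. k > 2 * m \<Longrightarrow> coeff P k = 0) \<Longrightarrow> L P = coeff P (2 * m)"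
    and b: "b ^ 2 = - 2 * e"
    and F: "F \<in> S2_polys (2 * m + 1) a e b" and F': "F' \<in> S2_polys (2 * m + 1) a e b"
  shows "L (F * F') = 0"
proof -
  define y :: "'a poly" where "y = monom 1 m"
  define z :: "'a poly" where "z = monom 1 (m - 1)"
  define x :: "'a poly" where "x = monom 1 1"
  define H where "H = (\<Sum>j=1..m. monom (a j) (m - j)) + monom 1 m"
  \<comment> \<open>\<open>Q\<close> is the full twist \<open>b x^m + e G\<close>; an element of
    \<open>S2_polys\<close> is \<open>A f + f 0 * Q\<close>, where \<open>A f\<close> has degree
    below \<open>m\<close> and is split into its constant term and \<open>x * B f\<close>.\<close>
  define Q where "Q = [:b:] * y + [:e:] * y * H"
  define B where "B f = (\<Sum>i<m - 1. monom (f (Suc i)) i)" for f :: "nat \<Rightarrow> 'a"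
  define A where "A f = [:f 0:] + x * B f" for f
  \<comment> \<open>\<open>K\<close> is the cofactor in \<open>Q^2 = b^2 y^2 + y^2 H K\<close>,
    where \<open>y^2 H = z (g - c)\<close>.\<close>
  define K where "K = [:2 * b * e:] + [:e ^ 2:] * H"
  have yxz: "y = x * z"
    using \<open>m \<ge> 1\<close> by (simp add: y_def x_def z_def mult_monom)
  have gH: "g = x * y * H + [:c:]"
    unfolding g H_def x_def y_def
    by (auto simp: mult_monom distrib_left sum_distrib_left mult_2 intro!: sum.cong
        arg_cong2[where f = monom])
  have coeff_H: "coeff H m = 1" "\<And>k. k > m \<Longrightarrow> coeff H k = 0"
    using \<open>m \<ge> 1\<close> by (auto simp: H_def coeff_sum intro!: sum.neutral)
  have coeff_B: "coeff (B f) k = 0" if "k \<ge> m - 1" for f k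
    using that by (auto simp: B_def coeff_sum intro!: sum.neutral)
  have coeff_A: "coeff (A f) k = 0" if "k \<ge> m" for f k
    using that \<open>m \<ge> 1\<close> coeff_B[of "k - 1" f]
    by (auto simp: A_def x_def coeff_monom_mult coeff_pCons split: nat.splits)
  have S2: "\<exists>f. P = A f + smult (f 0) Q" if P: "P \<in> S2_polys (2 * m + 1) a e b" for P
  proof -
    obtain f where "P = (\<Sum>i=0..(2 * m + 1 - 3) div 2. monom (f i) i)
        + monom (f 0 * b) ((2 * m + 1 - 1) div 2) + smult (f 0 * e)
          ((\<Sum>j=1..(2 * m + 1 - 1) div 2. monom (a j) (2 * m + 1 - 1 - j)) + monom 1 (2 * m + 1 - 1))"
      using P unfolding S2_polys_def by blast
    then have P_eq: "P = (\<Sum>i=0..(2 * m + 1 - 3) div 2. monom (f i) i) + monom (f 0 * b) m +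
      smult (f 0 * e) ((\<Sum>j=1..m. monom (a j) (2 * m - j)) + monom 1 (2 * m))"
      by simp
    have "{0..(2 * m + 1 - 3) div 2} = {..<Suc (m - 1)}"
      using \<open>m \<ge> 1\<close> by auto
    then have "(\<Sum>i=0..(2 * m + 1 - 3) div 2. monom (f i) i) = A f"
      by (simp only: sum.lessThan_Suc_shift)
        (simp add: A_def B_def x_def sum_distrib_left mult_monom monom_0)
    moreover have "(\<Sum>j=1..m. monom (a j) (2 * m - j)) + monom 1 (2 * m) = y * H"
      unfolding H_def y_def
      by (auto simp: mult_monom distrib_left sum_distrib_left mult_2 intro!: sum.cong
          arg_cong2[where f = monom])
    moreover have "monom (f 0 * b) m = smult (f 0) ([:b:] * y)"
      by (simp add: y_def smult_monom)
    ultimately have "P = A f + smult (f 0) Q"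
      unfolding P_eq Q_def by (simp add: smult_add_right mult.assoc)
    then show ?thesis by blast
  qed
  have const: "[:- d:] = - [:d:]" "[:d * d':] = [:d:] * [:d':]" "[:d ^ 2:] = [:d:] * [:d:]"
    "[:2:] = (2 :: 'a poly)" "smult d P = [:d:] * P" for d d' :: 'a and P
    by (simp_all add: numeral_poly power2_eq_square)
  \<comment> \<open>Both factors have degree below \<open>m\<close>, so the product has no term in
    degree \<open>2 * m\<close> or above.\<close>
  have LAA: "L (A f * A f') = 0" for f f'
  proof -
    have "coeff (A f * A f') k = 0" if "k \<ge> 2 * m" for k
      unfolding coeff_mult
    proof (rule sum.neutral, clarify)
      fix i assume "i \<le> k"
      then have "i \<ge> m \<or> k - i \<ge> m" using that by linarith
      then show "coeff (A f) i * coeff (A f') (k - i) = 0"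
        by (auto simp: coeff_A)
    qed
    then show ?thesis
      using coeff[of "A f * A f'"] by simp
  qed
  \<comment> \<open>\<open>H\<close> is monic of degree \<open>m\<close>, so the coefficient of
    \<open>Q\<close> at \<open>2 * m\<close> is \<open>e\<close>.\<close>
  have LQ: "L Q = e"
    using \<open>m \<ge> 1\<close> coeff[of Q] by (auto simp: Q_def y_def coeff_monom_mult coeff_H mult_2 mult.assoc)
  have LAQ: "L (A f * Q) = f 0 * e" for f
  proof -
    \<comment> \<open>Replacing \<open>x * y * H\<close> by \<open>g - c\<close> in
      \<open>x * B f * Q\<close> leaves two terms of degree below \<open>2 * m\<close>; only
      \<open>f 0 * Q\<close> contributes.\<close>
    have "A f * Q = (smult (f 0) Q + [:b:] * (x * y * B f) + [:- (c * e):] * B f)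
        + g * ([:e:] * B f)"
      unfolding A_def Q_def gH const by algebra
    moreover have "L ([:b:] * (x * y * B f)) = 0"
    proof -
      have "coeff ([:b:] * (x * y * B f)) k = 0" if "k \<ge> 2 * m" for k
        using that by (auto simp: x_def y_def mult_monom coeff_monom_mult intro!: coeff_B)
      then show ?thesis
        using coeff by simp
    qed
    moreover have "L ([:- (c * e):] * B f) = 0"
    proof -
      have "coeff ([:- (c * e):] * B f) k = 0" if "k \<ge> 2 * m" for k
        using that by (auto intro!: coeff_B)
      then show ?thesis
        using coeff by simp
    qed
    ultimately show ?thesis
      by (simp add: add smult multiple LQ del: mult_pCons_left mult_pCons_right)
  qed
  have LQQ: "L (Q * Q) = b ^ 2"
  proof -
    \<comment> \<open>After the multiple of \<open>g\<close> is split off, \<open>z * K\<close> has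
      degree at most \<open>2 * m - 1\<close>, so only \<open>b^2 x^(2m)\<close>
      contributes.\<close>
    have "Q * Q = ([:b ^ 2:] * (y * y) + [:- c:] * (z * K)) + g * (z * K)"
      unfolding K_def Q_def gH const yxz by algebra
    moreover have "L ([:b ^ 2:] * (y * y)) = b ^ 2"
      using coeff[of "[:b ^ 2:] * (y * y)"] by (simp add: y_def mult_monom smult_monom mult_2)
    moreover have "L ([:- c:] * (z * K)) = 0"
    proof -
      have "coeff ([:- c:] * (z * K)) k = 0" if "k \<ge> 2 * m" for k
        using that \<open>m \<ge> 1\<close>
        by (auto simp: z_def K_def coeff_monom_mult coeff_H coeff_pCons split: nat.splits)
      then show ?thesis
        using coeff by simp
    qed
    ultimately show ?thesis
      by (simp add: add multiple del: mult_pCons_left mult_pCons_right)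
  qed
  obtain f f' where f: "F = A f + smult (f 0) Q" and f': "F' = A f' + smult (f' 0) Q"
    using S2[OF F] S2[OF F'] by blast
  have "F * F' = A f * A f' + (smult (f' 0) (A f * Q) + (smult (f 0) (A f' * Q)
      + smult (f 0 * f' 0) (Q * Q)))"
    unfolding f f' by (simp add: algebra_simps smult_add_right)
  then have "L (F * F') = f 0 * f' 0 * (2 * e + b ^ 2)"
    by (simp add: add smult LAA LAQ LQQ) (simp add: algebra_simps)
  then show ?thesis
    by (simp add: b)
qed

section \<open>Existence of the square roots and properties of the code\<close>

theorem theorem35:
  fixes p s h t r q n :: nat
    and Fq Fpt D :: "'a::{field,finite} set"
    and g :: "'a poly" and a \<eta> :: "nat \<Rightarrow> 'a" and c :: 'a
    and \<alpha> :: "'a ^ 'n::finite"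
  assumes "prime p" "odd p"
    and "s > 0" "h > 0" "t > 0" "r > 0" "odd r" "t dvd h" "s < h"
    and "q = p ^ h" and "q mod 8 = 1 \<or> q mod 8 = 3"
    and "n = r * p ^ s" and "CARD('n) = n"
    and "CARD('a) = q ^ 2"
    and "is_subfield Fq" "card Fq = q"
    and "is_subfield Fpt" "card Fpt = p ^ t"
    and "g = monom 1 n + (\<Sum>i=1..(n - 1) div 2. monom (a i) (n - i)) + [:c:]"
    and "\<forall>i. coeff g i \<in> Fpt"
    and "c \<noteq> 0" and "\<forall>i\<in>{1..(n - 1) div 2}. a i \<noteq> 0"
    and "is_splitting_field Fpt Fq g"
    and "inj (($) \<alpha>)" and "range (($) \<alpha>) = {x. poly g x = 0}"
    and "D = {x \<in> Fq. x \<noteq> 0 \<and> x ^ ((q - 1) div 2) = 1}"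
    and "\<eta> ((n + 1) div 2) \<in> D"
  shows "(\<exists>b\<in>Fq. b ^ 2 = - 2 * \<eta> ((n + 1) div 2)) \<and>
    (\<exists>v :: 'a ^ 'n. \<forall>i. (v $ i) ^ 2 = inverse (poly (pderiv g) (\<alpha> $ i))) \<and>
    (\<forall>b\<in>Fq. \<forall>v :: 'a ^ 'n.
       b ^ 2 = - 2 * \<eta> ((n + 1) div 2) \<longrightarrow>
       (\<forall>i. (v $ i) ^ 2 = inverse (poly (pderiv g) (\<alpha> $ i))) \<longrightarrow>
       \<eta> 1 = \<eta> ((n + 1) div 2) * a ((n - 1) div 2) + b \<longrightarrow>
       (\<forall>i\<in>{2..(n - 1) div 2}. \<eta> i = \<eta> ((n + 1) div 2) * a ((n + 1) div 2 - i)) \<longrightarrow>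
       (let C = ev \<alpha> v ` S2_polys n a (\<eta> ((n + 1) div 2)) b in
          is_linear_code (r * p ^ s) ((r * p ^ s - 1) div 2) C \<and>
          self_orthogonal C \<and>
          is_tgrs_code ((r * p ^ s - 1) div 2) C))"
proof -
  define m where "m = (n - 1) div 2"
  define e where "e = \<eta> ((n + 1) div 2)"
  define w where "w i = inverse (poly (pderiv g) (\<alpha> $ i))" for i
  note p = \<open>prime p\<close> \<open>odd p\<close> and q = \<open>q mod 8 = 1 \<or> q mod 8 = 3\<close>
    and g = \<open>g = monom 1 n + (\<Sum>i=1..(n - 1) div 2. monom (a i) (n - i)) + [:c:]\<close>
  note Fq = \<open>is_subfield Fq\<close> \<open>card Fq = q\<close>
  have "odd n"
    using p \<open>odd r\<close> by (simp add: \<open>n = r * p ^ s\<close>)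
  then have n: "n = 2 * m + 1"
    by (simp add: m_def)
  \<comment> \<open>The odd prime \<open>p\<close> divides \<open>n\<close>, so \<open>n\<close> is
    at least 3 and the dimension \<open>m\<close> is positive, as a TGRS code requires.\<close>
  have "p dvd n"
    using \<open>s > 0\<close> by (simp add: \<open>n = r * p ^ s\<close>)
  then have "p \<le> n" using \<open>odd n\<close> by (intro dvd_imp_le) (auto intro: Nat.gr0I)
  moreover have "p \<ge> 3"
    using p prime_ge_2_nat[of p] by (cases "p = 2") auto
  ultimately have "m \<ge> 1" using n by simp
  have "odd q" using p by (simp add: \<open>q = p ^ h\<close>)
  then obtain k where k: "q = 2 * k + 1" by (elim oddE)

  have coeff_g: "coeff g n = 1" "\<And>l. l > n \<Longrightarrow> coeff g l = 0"
    unfolding g using \<open>m \<ge> 1\<close> n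
    by (auto simp: coeff_sum coeff_pCons split: nat.splits intro!: sum.neutral)
  then have deg_g: "degree g = n"
    by (metis degree_le le_antisym le_degree zero_neq_one)
  have root: "poly g (\<alpha> $ i) = 0" for i
    using \<open>range (($) \<alpha>) = {x. poly g x = 0}\<close> by blast
  have g_prod: "g = (\<Prod>i\<in>UNIV. [:- \<alpha> $ i, 1:])"
    using \<open>inj (($) \<alpha>)\<close> root deg_g coeff_g \<open>CARD('n) = n\<close> by (intro monic_eq_prod_roots) auto
  have g': "poly (pderiv g) (\<alpha> $ i) = (\<Prod>j\<in>UNIV - {i}. \<alpha> $ i - \<alpha> $ j)" for i
    unfolding g_prod by (rule poly_pderiv_prod_roots)
  have w_nz: "w i \<noteq> 0" for i
    using \<open>inj (($) \<alpha>)\<close> by (auto simp: w_def g' inj_eq)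

  \<comment> \<open>As \<open>g\<close> splits over \<open>Fq\<close>, its roots lie there, and
    hence so do the weights \<open>w i\<close>.\<close>
  have \<alpha>_Fq: "\<alpha> $ i \<in> Fq" for i
  proof -
    obtain xs where xs: "set xs \<subseteq> Fq" "g = smult (lead_coeff g) (\<Prod>x\<leftarrow>xs. [:- x, 1:])"
      using \<open>is_splitting_field Fpt Fq g\<close> by (auto simp: is_splitting_field_def splits_over_def)
    then have "g = (\<Prod>x\<leftarrow>xs. [:- x, 1:])"
      using deg_g coeff_g by simp
    then have "poly (\<Prod>x\<leftarrow>xs. [:- x, 1:]) (\<alpha> $ i) = 0"
      using root by simp
    moreover have "z \<in> set ys" if "poly (\<Prod>x\<leftarrow>ys. [:- x, 1:]) z = 0" for z and ys :: "'a list"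
      using that by (induction ys) auto
    ultimately show ?thesis
      using xs(1) by blast
  qed
  have "w i \<in> Fq" for i
  proof -
    have "(\<Prod>j\<in>A. \<alpha> $ i - \<alpha> $ j) \<in> Fq" for A
      using Fq(1) \<alpha>_Fq by (induction A rule: infinite_finite_induct) (auto simp: is_subfield_def)
    then show ?thesis
      using Fq(1) by (simp add: w_def g' is_subfield_def)
  qed
  \<comment> \<open>Every nonzero element of \<open>Fq\<close> is a square in the ambient field:
    with \<open>q = 2 * k + 1\<close>, half of \<open>q ^ 2 - 1\<close> is
    \<open>2 * k * (k + 1)\<close>, a multiple of \<open>q - 1\<close>.\<close>
  have "\<exists>y. y ^ 2 = w i" for i
  proof -
    have "w i ^ (2 * k) = 1"
      using subfield_power_card[OF Fq(1) \<open>w i \<in> Fq\<close> w_nz] Fq(2) k by simp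
    moreover have "(CARD('a) - 1) div 2 = 2 * k * (k + 1)"
      by (simp add: \<open>CARD('a) = q ^ 2\<close> k power2_eq_square)
    ultimately have "w i ^ ((CARD('a) - 1) div 2) = 1"
      by (simp only: power_mult power_one)
    then show ?thesis
      using subfield_Euler_criterion[OF is_subfield_UNIV, of "w i"] \<open>CARD('a) = q ^ 2\<close> \<open>odd q\<close>
      by auto
  qed
  then obtain v0 where "\<And>i. v0 i ^ 2 = w i" by metis
  then have ex_v: "\<exists>v :: 'a ^ 'n. \<forall>i. (v $ i) ^ 2 = w i"
    by (intro exI[of _ "\<chi> i. v0 i"]) simp

  \<comment> \<open>Both \<open>- 2\<close> and \<open>e\<close> have
    \<open>(q - 1) div 2\<close>-th power 1, hence so does their product, and Euler's criterion
    applies inside \<open>Fq\<close>.\<close>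
  have ex_b: "\<exists>b\<in>Fq. b ^ 2 = - 2 * e"
  proof (rule subfield_Euler_criterion[OF Fq(1)])
    have e: "e \<in> Fq" "e ^ ((q - 1) div 2) = 1"
      using \<open>\<eta> ((n + 1) div 2) \<in> D\<close> by (auto simp: e_def \<open>D = _\<close>)
    \<comment> \<open>This form fits \<open>is_subfield\<close>, which states closure under
      differences.\<close>
    have "0 - e - e \<in> Fq"
      using Fq(1) e unfolding is_subfield_def by blast
    moreover have "- 2 * e = 0 - e - e" by simp
    ultimately show "- 2 * e \<in> Fq" by (simp only:)
    show "(- 2 * e) ^ ((card Fq - 1) div 2) = 1"
      using minus_two_power[OF \<open>prime p\<close> \<open>q = p ^ h\<close> q \<open>CARD('a) = q ^ 2\<close>] e
      by (simp only: power_mult_distrib Fq(2) mult_1)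
  qed (simp add: Fq \<open>odd q\<close>)

  have code: "is_linear_code n m C \<and> self_orthogonal C \<and> is_tgrs_code m C"
    if b: "b ^ 2 = - 2 * e" and v: "\<And>i. (v $ i) ^ 2 = w i" and C: "C = ev \<alpha> v ` S2_polys n a e b"
    for b and v :: "'a ^ 'n" and C
  proof (intro conjI)
    have v_nz: "v $ i \<noteq> 0" for i
      using v[of i] w_nz[of i] by auto
    obtain M where "S2_polys n a e b = tgrs_polys n m M"
      using S2_polys_eq_tgrs_polys[OF \<open>m \<ge> 1\<close>, of a e b] unfolding n[symmetric] by blast
    then have M: "C = ev \<alpha> v ` tgrs_polys CARD('n) m M"
      by (simp only: C \<open>CARD('n) = n\<close>)
    show "is_linear_code n m C"
      using is_linear_code_tgrs[of \<alpha> v m M] \<open>inj (($) \<alpha>)\<close> v_nz \<open>m \<ge> 1\<close> M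
      by (simp add: \<open>CARD('n) = n\<close> n)
    show "is_tgrs_code m C"
      unfolding is_tgrs_code_def
      using M \<open>inj (($) \<alpha>)\<close> v_nz \<open>m \<ge> 1\<close> \<open>CARD('n) = n\<close> n by auto
    \<comment> \<open>The weights are the inverses of \<open>g'\<close> at the roots, so
      interpolation evaluates \<open>L\<close> in degree at most \<open>2 * m\<close>, and multiples
      of \<open>g\<close> are annihilated.\<close>
    define L where "L P = (\<Sum>i\<in>UNIV. poly P (\<alpha> $ i) * w i)" for P
    have L_coeff: "L P = coeff P (2 * m)" if "\<And>l. l > 2 * m \<Longrightarrow> coeff P l = 0" for P
    proof -
      have "degree P \<le> 2 * m" using that by (simp add: degree_le)
      then show ?thesis
        using lagrange_lead_coeff[of "($) \<alpha>" P] \<open>inj (($) \<alpha>)\<close> \<open>CARD('n) = n\<close> n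
        by (simp add: L_def w_def g' divide_inverse)
    qed
    have L0: "L (F * F') = 0" if "F \<in> S2_polys n a e b" "F' \<in> S2_polys n a e b" for F F'
    proof (rule S2_product_annihilated[where L = L and g = g, OF \<open>m \<ge> 1\<close> _ _ _ _ L_coeff b])
      show "g = monom 1 (2 * m + 1) + (\<Sum>i=1..m. monom (a i) (2 * m + 1 - i)) + [:c:]"
        unfolding g m_def[symmetric] by (simp add: n)
      show "L (P + Q) = L P + L Q" for P Q
        by (simp add: L_def distrib_right sum.distrib)
      show "L (smult d P) = d * L P" for d P
        by (simp add: L_def sum_distrib_left mult.assoc)
      show "L (g * P) = 0" for P
        by (simp add: L_def root)
    qed (use that n in auto)
    \<comment> \<open>The two factors \<open>v $ i\<close> multiply to \<open>w i\<close>.\<close>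
    have "scalar_product (ev \<alpha> v F) (ev \<alpha> v F') = L (F * F')" for F F'
      by (simp add: scalar_product_def ev_def L_def v[symmetric] power2_eq_square mult_ac)
    then show "self_orthogonal C"
      using L0 by (auto simp: self_orthogonal_def dual_code_def C)
  qed
  show ?thesis
    unfolding Let_def \<open>n = r * p ^ s\<close>[symmetric] m_def[symmetric] e_def[symmetric] w_def[symmetric]
  proof (intro conjI ballI allI impI)
    fix b and v :: "'a ^ 'n"
    assume "b ^ 2 = - 2 * e" "\<forall>i. (v $ i) ^ 2 = w i"
    note C = code[OF this(1) this(2)[rule_format] refl]
    show "is_linear_code n m (ev \<alpha> v ` S2_polys n a e b)"
      "self_orthogonal (ev \<alpha> v ` S2_polys n a e b)"
      "is_tgrs_code m (ev \<alpha> v ` S2_polys n a e b)"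
      using C by blast+
  qed (fact ex_b ex_v)+
qed

end
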